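(* Let $f=\sum_{i=1}^m f_i$ with $f_i:\mathbb{R}^d\to\mathbb{R}$. Assume that: (i) each $f_i$ is convex and has $L$-Lipschitz continuous gradient, i.e. $f_i(x)+\langle\nabla f_i(x),y-x\rangle\le f_i(y)\le f_i(x)+\langle\nabla f_i(x),y-x\rangle+\frac L2\|y-x\|^2$ for all $x,y\in\mathbb{R}^d$; (ii) $f_i(x)=\ell(a_i^Tx,b_i)$ with $a_i\in\mathbb{R}^d$, $b_i\in\mathbb{R}$, and $\mathrm{supp}(\nabla f_i(x))=\mathrm{supp}(a_i)$ for every $x$ and $i$. Let $\sigma=\min\big(\sqrt{m(1+\Delta_{\rm ave})},1+\Delta_{\max}\big)$ and $\theta>0$. Let $Q$ be an unbiased random quantizer with variance parameter $\alpha$, and suppose $\gamma=1/(L\alpha(1+\theta)\sigma)$. Then the iterates generated by $$x_{k+1}=x_k-\gamma\sum_{i=1}^mQ(\nabla f_i(x_k))$$ satisfy, for every integer $T\ge1$, $$\mathbf{E}\big(f(\bar x_T)-f(x^\star)\big)\le\frac1\gamma\,\frac1T\|x_0-x^\star\|^2+\frac1{\theta L}\sum_{i=1}^m\|\nabla f_i(x^\star)\|^2,$$ where $\bar x_T=\frac1T\sum_{k=0}^{T-1}x_k$.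
   Context: $\|\cdot\|$ is the Euclidean norm and $\mathrm{supp}(x)=\{i: x^i\ne0\}$. $x^\star$ is a minimizer of $f$ (assumed to exist). $x_0\in\mathbb{R}^d$ is a deterministic initial point. Conflict graph degrees: $\Delta_{\rm ave}=\frac1m\sum_{i=1}^m\sum_{j\ne i}\mathbf 1\{\mathrm{supp}(a_i)\cap\mathrm{supp}(a_j)\ne\emptyset\}$ and $\Delta_{\max}=\max_{i}\sum_{j\ne i}\mathbf 1\{\mathrm{supp}(a_i)\cap\mathrm{supp}(a_j)\ne\emptyset\}$. An unbiased random quantizer (URQ) with parameter $\alpha$ (finite, positive) is a random mapping $Q:\mathbb{R}^d\to\mathbb{R}^d$ such that for every $v\in\mathbb{R}^d$: $\mathrm{supp}(Q(v))\subseteq\mathrm{supp}(v)$, $\mathbf{E}\{Q(v)\}=v$, and $\mathbf{E}\{\|Q(v)\|^2\}\le\alpha\|v\|^2$. Each application of $Q$ in the algorithm uses fresh randomness, so these properties hold conditionally on the past iterates. *)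

theory Defs
  imports "HOL-Probability.Probability"
begin

definition supp :: "real ^ 'd \<Rightarrow> 'd set" where
  "supp x = {i. x $ i \<noteq> 0}"

text \<open>Degree of node \<open>i\<close> in the conflict graph of \<open>a 1, \<dots>, a m\<close>.\<close>

definition conflict_degree :: "nat \<Rightarrow> (nat \<Rightarrow> real ^ 'd) \<Rightarrow> nat \<Rightarrow> real" where
  "conflict_degree m a i = (\<Sum>j\<in>{1..m} - {i}. of_bool (supp (a i) \<inter> supp (a j) \<noteq> {}))"

definition Delta_ave :: "nat \<Rightarrow> (nat \<Rightarrow> real ^ 'd) \<Rightarrow> real" where
  "Delta_ave m a = (1 / real m) * (\<Sum>i=1..m. conflict_degree m a i)"

definition Delta_max :: "nat \<Rightarrow> (nat \<Rightarrow> real ^ 'd) \<Rightarrow> real" where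
  "Delta_max m a = Max (conflict_degree m a ` {1..m})"

text \<open>
  A random mapping is given by a probability space \<open>N\<close> of seeds and a jointly measurable
  \<open>Q\<close>; \<open>Q s v\<close> is the value at the vector \<open>v\<close> when the seed \<open>s\<close> is drawn.
  Both integrability conditions are implicit in the two moment conditions; they have to be
  spelled out since the Bochner integral of a non-integrable function is \<open>0\<close>.
\<close>

definition unbiased_random_quantizer ::
    "real \<Rightarrow> 's measure \<Rightarrow> ('s \<Rightarrow> real ^ 'd \<Rightarrow> real ^ 'd) \<Rightarrow> bool" where
  "unbiased_random_quantizer \<alpha> N Q \<longleftrightarrow>
     0 < \<alpha> \<and> prob_space N \<and>
     (\<lambda>(s, v). Q s v) \<in> borel_measurable (N \<Otimes>\<^sub>M borel) \<and>
     (\<forall>v. (AE s in N. supp (Q s v) \<subseteq> supp v) \<and>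
          integrable N (\<lambda>s. Q s v) \<and>
          (\<integral>s. Q s v \<partial>N) = v \<and>
          integrable N (\<lambda>s. (norm (Q s v))\<^sup>2) \<and>
          (\<integral>s. (norm (Q s v))\<^sup>2 \<partial>N) \<le> \<alpha> * (norm v)\<^sup>2)"

text \<open>
  Fresh randomness: the application of a random mapping with seed space \<open>N\<close> in iteration
  \<open>k\<close> to the \<open>i\<close>-th gradient uses the seed \<open>\<xi> k i\<close>; all seeds are independent,
  with law \<open>N\<close>.
\<close>

definition fresh_seeds ::
    "'w measure \<Rightarrow> 's measure \<Rightarrow> nat \<Rightarrow> (nat \<Rightarrow> nat \<Rightarrow> 'w \<Rightarrow> 's) \<Rightarrow> bool" where
  "fresh_seeds M N m \<xi> \<longleftrightarrow>
     prob_space.indep_vars M (\<lambda>_. N) (\<lambda>(k, i). \<xi> k i) (UNIV \<times> {1..m}) \<and>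
     (\<forall>k. \<forall>i\<in>{1..m}. distr M N (\<xi> k i) = N)"

end

theory Submission
  imports Defs
begin

text \<open>
  The proof follows the squared distance of the iterates to \<open>xstar\<close>. Write \<open>g\<^sub>i\<close> for the gradient
  of \<open>f i\<close>, \<open>D = x k - xstar\<close> and \<open>q\<^sub>i\<close> for the quantized gradients of iteration \<open>k\<close>. Expanding
  the square,
  \<open>|x (k+1) - xstar|\<^sup>2 = |D|\<^sup>2 - 2 \<gamma> \<Sum>\<^sub>i q\<^sub>i \<bullet> D + \<gamma>\<^sup>2 |\<Sum>\<^sub>i q\<^sub>i|\<^sup>2\<close>, and three facts control the result.

  \<^item> Sparsity. A quantizer does not enlarge supports, so \<open>q\<^sub>i \<bullet> q\<^sub>j\<close> vanishes unless \<open>i = j\<close> or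
    \<open>i\<close> and \<open>j\<close> are adjacent in the conflict graph. Estimating the remaining products by the
    inequality between arithmetic and geometric mean, or by Cauchy-Schwarz over the set of adjacent
    pairs, gives the two factors whose minimum is \<open>\<sigma>\<close>: \<open>|\<Sum>\<^sub>i q\<^sub>i|\<^sup>2 \<le> \<sigma> \<Sum>\<^sub>i |q\<^sub>i|\<^sup>2\<close>
    (\<open>norm_sum_sq_le_conflict_factor\<close>).

  \<^item> Fresh randomness. The iterate \<open>x k\<close> is a function of the seeds of earlier iterations and is
    hence independent of every single seed of iteration \<open>k\<close>
    (\<open>iterate_independent_of_fresh_seed\<close>). By Fubini one may therefore integrate over the
    seed first, so that in expectation \<open>q\<^sub>i \<bullet> D\<close> becomes \<open>g\<^sub>i (x k) \<bullet> D\<close> and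
    \<open>|q\<^sub>i|\<^sup>2\<close> is at most \<open>\<alpha> |g\<^sub>i (x k)|\<^sup>2\<close> (\<open>quantizer_unbiased\<close>, \<open>quantizer_second_moment\<close>).

  \<^item> Smoothness. A convex function with \<open>L\<close>-Lipschitz gradient lies above its tangents by at least
    the squared difference of the gradients over \<open>2 L\<close>
    (\<open>convex_lipschitz_gradient_lower_bound\<close>). Splitting \<open>g\<^sub>i (x k)\<close> into \<open>g\<^sub>i (x k) - g\<^sub>i xstar\<close> and
    \<open>g\<^sub>i xstar\<close> with weights \<open>1 + \<theta>\<close> and \<open>1 + 1 / \<theta>\<close>, the step size \<open>\<gamma>\<close> is exactly such that the
    first part is absorbed by this surplus, while the second one leaves
    \<open>\<gamma> / (\<theta> L) \<Sum>\<^sub>i |g\<^sub>i xstar|\<^sup>2\<close> (\<open>drift_le_noise_minus_gap\<close>).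

  Together, the expected squared distance decreases in each iteration by at least
  \<open>2 \<gamma> (F (x k) - F xstar)\<close> in expectation, up to that constant. The theorem follows by telescoping
  and by Jensen's inequality for the average of the iterates; the bound obtained in this way is
  half of the claimed one.
\<close>

section \<open>Convex functions with Lipschitz gradient\<close>

lemma has_real_derivative_along_line:
  fixes f :: "'a::real_inner \<Rightarrow> real"
  assumes "GDERIV f (x + t *\<^sub>R h) :> D"
  shows "((\<lambda>s. f (x + s *\<^sub>R h)) has_real_derivative h \<bullet> D) (at t)"
proof -
  have "((\<lambda>s. x + s *\<^sub>R h) has_derivative (\<lambda>s. s *\<^sub>R h)) (at t)"
    by (auto intro!: derivative_eq_intros)
  from has_derivative_compose[OF this, of f "\<lambda>v. v \<bullet> D"] assms
  show ?thesis
    by (simp add: gderiv_def has_field_derivative_def mult_commute_abs)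
qed

text \<open>The restriction to the line through \<open>x\<close> and \<open>y\<close> is convex, which reduces the claim to the
  tangent inequality for functions of one real variable.\<close>

lemma convex_gradient_lower_bound:
  fixes f :: "'a::real_inner \<Rightarrow> real"
  assumes "convex_on UNIV f" and "GDERIV f x :> D"
  shows "f x + D \<bullet> (y - x) \<le> f y"
proof -
  define \<phi> where "\<phi> t = f (x + t *\<^sub>R (y - x))" for t :: real
  have "convex_on UNIV \<phi>"
  proof (rule convex_onI)
    fix t u v :: real assume "0 < t" "t < 1"
    moreover have "x + ((1 - t) *\<^sub>R u + t *\<^sub>R v) *\<^sub>R (y - x)
        = (1 - t) *\<^sub>R (x + u *\<^sub>R (y - x)) + t *\<^sub>R (x + v *\<^sub>R (y - x))"
      by (simp add: algebra_simps)
    ultimately show "\<phi> ((1 - t) *\<^sub>R u + t *\<^sub>R v) \<le> (1 - t) * \<phi> u + t * \<phi> v"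
      unfolding \<phi>_def using convex_onD[OF assms(1), of t] by simp
  qed simp
  moreover have "(\<phi> has_real_derivative (y - x) \<bullet> D) (at 0)"
    unfolding \<phi>_def using assms(2) by (intro has_real_derivative_along_line) simp
  ultimately have "(y - x) \<bullet> D * (1 - 0) \<le> \<phi> 1 - \<phi> 0"
    by (intro convex_on_imp_above_tangent[of UNIV]) auto
  then show ?thesis
    by (simp add: \<phi>_def inner_commute)
qed

text \<open>Along the segment from \<open>x\<close> to \<open>y\<close>, the difference of the two sides has derivative
  \<open>h \<bullet> (g (x + t h) - g x) - L t |h|\<^sup>2\<close>, which the Lipschitz condition makes nonpositive.\<close>

lemma lipschitz_gradient_upper_bound:
  fixes f :: "'a::real_inner \<Rightarrow> real"
  assumes grad: "\<And>z. GDERIV f z :> g z" and lip: "L-lipschitz_on UNIV g"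
  shows "f y \<le> f x + g x \<bullet> (y - x) + L / 2 * (norm (y - x))\<^sup>2"
proof -
  define h where "h = y - x"
  define \<phi> where "\<phi> t = f (x + t *\<^sub>R h) - t * (h \<bullet> g x) - L / 2 * t\<^sup>2 * (norm h)\<^sup>2" for t :: real
  have "\<phi> 1 \<le> \<phi> 0"
  proof (rule DERIV_nonpos_imp_nonincreasing[of 0 1 \<phi>])
    fix t :: real assume t: "0 \<le> t" "t \<le> 1"
    have "(\<phi> has_real_derivative h \<bullet> g (x + t *\<^sub>R h) - h \<bullet> g x - L * t * (norm h)\<^sup>2) (at t)"
      unfolding \<phi>_def
      by (auto intro!: derivative_eq_intros has_real_derivative_along_line[OF grad])
    moreover have "h \<bullet> (g (x + t *\<^sub>R h) - g x) \<le> norm h * (L * (t * norm h))"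
      using lipschitz_onD[OF lip, of "x + t *\<^sub>R h" x] t
      by (intro order_trans[OF norm_cauchy_schwarz] mult_left_mono) (auto simp: dist_norm)
    ultimately show "\<exists>d. (\<phi> has_real_derivative d) (at t) \<and> d \<le> 0"
      by (intro exI conjI) (auto simp: inner_diff_right power2_eq_square algebra_simps)
  qed simp
  then show ?thesis
    by (simp add: \<phi>_def h_def inner_commute)
qed

text \<open>Apply the tangent inequality at \<open>x\<close> and the quadratic upper bound at \<open>y\<close> to the point reached
  from \<open>y\<close> by a gradient step of length \<open>1 / L\<close> for the convex function \<open>z \<mapsto> f z - g x \<bullet> z\<close>, which
  has its minimum at \<open>x\<close>: the step decreases this function by at least
  \<open>|g y - g x|\<^sup>2 / (2 L)\<close>, and it cannot fall below its value at \<open>x\<close>.\<close>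

lemma convex_lipschitz_gradient_lower_bound:
  fixes f :: "'a::real_inner \<Rightarrow> real"
  assumes "convex_on UNIV f" and grad: "\<And>z. GDERIV f z :> g z"
    and lip: "L-lipschitz_on UNIV g" and "0 < L"
  shows "f x + g x \<bullet> (y - x) + (norm (g y - g x))\<^sup>2 / (2 * L) \<le> f y"
proof -
  define d where "d = g y - g x"
  define z where "z = y - (1 / L) *\<^sub>R d"
  have "f x + g x \<bullet> (z - x) \<le> f z"
    using assms(1) grad by (rule convex_gradient_lower_bound)
  also have "\<dots> \<le> f y + g y \<bullet> (z - y) + L / 2 * (norm (z - y))\<^sup>2"
    using grad lip by (rule lipschitz_gradient_upper_bound)
  finally have "f x + g x \<bullet> (z - x) \<le> f y + g y \<bullet> (z - y) + L / 2 * (norm (z - y))\<^sup>2" .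
  moreover have "g x \<bullet> (z - x) = g x \<bullet> (y - x) - (g x \<bullet> d) / L"
    by (simp add: z_def inner_diff_right)
  moreover have "g y \<bullet> (z - y) = - (g x \<bullet> d) / L - (norm d)\<^sup>2 / L"
  proof -
    have "g y = g x + d" by (simp add: d_def)
    then show ?thesis
      by (simp add: z_def power2_norm_eq_inner inner_left_distrib add_divide_distrib)
  qed
  moreover have "L / 2 * (norm (z - y))\<^sup>2 = (norm d)\<^sup>2 / (2 * L)"
    using \<open>0 < L\<close> by (simp add: z_def power_divide power2_eq_square)
  moreover have "(norm d)\<^sup>2 / L = 2 * ((norm d)\<^sup>2 / (2 * L))"
    by simp
  ultimately show ?thesis
    unfolding d_def[symmetric] by linarith
qed

lemma norm_add_sq_le_weighted:
  fixes u v :: "'a::real_inner"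
  assumes "0 < \<theta>"
  shows "(norm (u + v))\<^sup>2 \<le> (1 + \<theta>) * (norm u)\<^sup>2 + (1 + 1 / \<theta>) * (norm v)\<^sup>2"
proof -
  have "0 \<le> (norm (\<theta> *\<^sub>R u - v))\<^sup>2 / \<theta>"
    using assms by simp
  also have "\<dots> = \<theta> * (norm u)\<^sup>2 - 2 * (u \<bullet> v) + (norm v)\<^sup>2 / \<theta>"
    using assms
    by (simp add: power2_norm_eq_inner inner_diff_left inner_diff_right inner_commute field_simps)
  finally show ?thesis
    by (simp add: power2_norm_eq_inner inner_add_left inner_add_right inner_commute algebra_simps)
qed

text \<open>The left-hand side bounds the expected change of the squared distance to \<open>z\<close> in one step from
  \<open>y\<close>, when \<open>\<kappa>\<close> is the product of the conflict factor and the parameter of the quantizer. By the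
  weighted triangle inequality, the hypothesis on \<open>\<gamma> \<kappa>\<close> gives
  \<open>|gradf i y - gradf i z|\<^sup>2\<close> the coefficient \<open>1 / L\<close>, which is what twice the tangent
  inequality with surplus provides.\<close>

lemma drift_le_noise_minus_gap:
  fixes f :: "'i \<Rightarrow> 'a::real_inner \<Rightarrow> real"
  assumes gradient: "\<And>i y. i \<in> I \<Longrightarrow> GDERIV (f i) y :> gradf i y"
    and convex: "\<And>i. i \<in> I \<Longrightarrow> convex_on UNIV (f i)"
    and smooth: "\<And>i. i \<in> I \<Longrightarrow> L-lipschitz_on UNIV (gradf i)"
    and L: "0 < L" and \<theta>: "0 < \<theta>" and \<gamma>: "0 < \<gamma>" and step_size: "\<gamma> * \<kappa> = 1 / (L * (1 + \<theta>))"
  shows "\<gamma>\<^sup>2 * \<kappa> * (\<Sum>i\<in>I. (norm (gradf i y))\<^sup>2) - 2 * \<gamma> * (\<Sum>i\<in>I. gradf i y \<bullet> (y - z))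
    \<le> \<gamma> / (\<theta> * L) * (\<Sum>i\<in>I. (norm (gradf i z))\<^sup>2) - 2 * \<gamma> * ((\<Sum>i\<in>I. f i y) - (\<Sum>i\<in>I. f i z))"
proof -
  have one: "\<gamma> * \<kappa> * (norm (gradf i y))\<^sup>2 - 2 * (gradf i y \<bullet> (y - z))
      \<le> 1 / (\<theta> * L) * (norm (gradf i z))\<^sup>2 - 2 * (f i y - f i z)" if i: "i \<in> I" for i
  proof -
    let ?d = "(norm (gradf i z - gradf i y))\<^sup>2"
    have "f i y + gradf i y \<bullet> (z - y) + ?d / (2 * L) \<le> f i z"
      using convex[OF i] gradient[OF i] smooth[OF i] L by (rule convex_lipschitz_gradient_lower_bound)
    then have "?d / L - 2 * (gradf i y \<bullet> (y - z)) \<le> - 2 * (f i y - f i z)"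
      by (simp add: inner_diff_right)
    moreover have "\<gamma> * \<kappa> * (norm (gradf i y))\<^sup>2 \<le> ?d / L + 1 / (\<theta> * L) * (norm (gradf i z))\<^sup>2"
    proof -
      have nz: "1 + \<theta> \<noteq> 0"
        using \<theta> by simp
      have "(norm (gradf i y))\<^sup>2 \<le> (1 + \<theta>) * ?d + (1 + 1 / \<theta>) * (norm (gradf i z))\<^sup>2"
        using norm_add_sq_le_weighted[OF \<theta>, of "gradf i y - gradf i z" "gradf i z"]
        by (simp add: norm_minus_commute)
      then have "\<gamma> * \<kappa> * (norm (gradf i y))\<^sup>2
          \<le> \<gamma> * \<kappa> * ((1 + \<theta>) * ?d + (1 + 1 / \<theta>) * (norm (gradf i z))\<^sup>2)"
        unfolding step_size using L \<theta> by (intro mult_left_mono) auto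
      also have "\<dots> = (\<gamma> * \<kappa> * (1 + \<theta>)) * ?d + (\<gamma> * \<kappa> * (1 + 1 / \<theta>)) * (norm (gradf i z))\<^sup>2"
        by (simp add: algebra_simps)
      also have "\<gamma> * \<kappa> * (1 + \<theta>) = 1 / L"
        unfolding step_size using nz by simp
      also have "\<gamma> * \<kappa> * (1 + 1 / \<theta>) = 1 / (\<theta> * L)"
      proof -
        have "1 + 1 / \<theta> = (1 + \<theta>) / \<theta>"
          using \<theta> by (simp add: add_divide_distrib)
        then show ?thesis
          unfolding step_size using nz by (simp add: mult.commute)
      qed
      finally show ?thesis by simp
    qed
    ultimately show ?thesis by linarith
  qed
  have "\<gamma>\<^sup>2 * \<kappa> * (\<Sum>i\<in>I. (norm (gradf i y))\<^sup>2) - 2 * \<gamma> * (\<Sum>i\<in>I. gradf i y \<bullet> (y - z))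
      = \<gamma> * (\<Sum>i\<in>I. \<gamma> * \<kappa> * (norm (gradf i y))\<^sup>2 - 2 * (gradf i y \<bullet> (y - z)))"
    by (simp add: sum_subtractf right_diff_distrib power2_eq_square mult.assoc flip: sum_distrib_left)
  also have "\<dots> \<le> \<gamma> * (\<Sum>i\<in>I. 1 / (\<theta> * L) * (norm (gradf i z))\<^sup>2 - 2 * (f i y - f i z))"
    using \<gamma> one by (intro mult_left_mono sum_mono) auto
  also have "\<dots> = \<gamma> / (\<theta> * L) * (\<Sum>i\<in>I. (norm (gradf i z))\<^sup>2)
      - 2 * \<gamma> * ((\<Sum>i\<in>I. f i y) - (\<Sum>i\<in>I. f i z))"
    by (simp add: sum_subtractf right_diff_distrib mult.assoc flip: sum_distrib_left sum_divide_distrib)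
  finally show ?thesis .
qed

section \<open>Sums of vectors with few overlapping supports\<close>

lemma inner_eq_0_if_disjoint_supp:
  assumes "supp u \<inter> supp v = {}"
  shows "u \<bullet> v = 0"
  using assms unfolding inner_vec_def by (intro sum.neutral) (auto simp: supp_def)

text \<open>Adjacency in the conflict graph with a loop at every node. The loops are the reason for the
  summand \<open>1\<close> that accompanies the degrees; they have to be added separately because \<open>supp (a i)\<close>
  may be empty.\<close>

definition conflict :: "(nat \<Rightarrow> real ^ 'd) \<Rightarrow> nat \<Rightarrow> nat \<Rightarrow> real" where
  "conflict a i j = of_bool (i = j \<or> supp (a i) \<inter> supp (a j) \<noteq> {})"

lemma conflict_commute: "conflict a i j = conflict a j i"
  by (auto simp: conflict_def)

lemma sum_conflict:
  assumes "i \<in> {1..m}"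
  shows "(\<Sum>j=1..m. conflict a i j) = 1 + conflict_degree m a i"
proof -
  have "(\<Sum>j\<in>{1..m} - {i}. conflict a i j) = conflict_degree m a i"
    unfolding conflict_degree_def by (rule sum.cong) (auto simp: conflict_def)
  moreover have "conflict a i i = 1"
    by (simp add: conflict_def)
  ultimately show ?thesis
    using sum.remove[of "{1..m}" i "conflict a i"] assms by simp
qed

lemma sum_sum_conflict:
  assumes "1 \<le> m"
  shows "(\<Sum>i=1..m. \<Sum>j=1..m. conflict a i j) = real m * (1 + Delta_ave m a)"
  using assms by (simp add: sum_conflict Delta_ave_def sum.distrib distrib_left del: One_nat_def)

lemma norm_sum_sq_le_conflict:
  assumes "\<And>i. i \<in> {1..m} \<Longrightarrow> supp (q i) \<subseteq> supp (a i)"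
  shows "(norm (\<Sum>i=1..m. q i))\<^sup>2 \<le> (\<Sum>i=1..m. \<Sum>j=1..m. conflict a i j * (norm (q i) * norm (q j)))"
proof -
  have "q i \<bullet> q j \<le> conflict a i j * (norm (q i) * norm (q j))"
    if "i \<in> {1..m}" "j \<in> {1..m}" for i j
  proof (cases "i = j \<or> supp (a i) \<inter> supp (a j) \<noteq> {}")
    case True
    then show ?thesis by (simp add: conflict_def norm_cauchy_schwarz)
  next
    case False
    then have "supp (q i) \<inter> supp (q j) = {}"
      using assms that by blast
    with False show ?thesis
      by (simp add: conflict_def inner_eq_0_if_disjoint_supp)
  qed
  then show ?thesis
    unfolding power2_norm_eq_inner inner_sum_right inner_sum_left
    by (subst sum.swap) (intro sum_mono)
qed

text \<open>Bounding each product of norms by the mean of the squares counts \<open>|q\<^sub>i|\<^sup>2\<close> once for every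
  neighbour of \<open>i\<close>, including \<open>i\<close> itself.\<close>

lemma norm_sum_sq_le_Delta_max:
  assumes "\<And>i. i \<in> {1..m} \<Longrightarrow> supp (q i) \<subseteq> supp (a i)"
  shows "(norm (\<Sum>i=1..m. q i))\<^sup>2 \<le> (1 + Delta_max m a) * (\<Sum>i=1..m. (norm (q i))\<^sup>2)"
proof -
  let ?c = "conflict a"
  have "(norm (\<Sum>i=1..m. q i))\<^sup>2 \<le> (\<Sum>i=1..m. \<Sum>j=1..m. ?c i j * (norm (q i) * norm (q j)))"
    using assms by (rule norm_sum_sq_le_conflict)
  also have "\<dots> \<le> (\<Sum>i=1..m. \<Sum>j=1..m. (?c i j * (norm (q i))\<^sup>2 + ?c i j * (norm (q j))\<^sup>2) / 2)"
  proof (intro sum_mono)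
    fix i j
    have "norm (q i) * norm (q j) \<le> ((norm (q i))\<^sup>2 + (norm (q j))\<^sup>2) / 2"
      using sum_squares_bound[of "norm (q i)" "norm (q j)"] by simp
    then have "?c i j * (norm (q i) * norm (q j)) \<le> ?c i j * (((norm (q i))\<^sup>2 + (norm (q j))\<^sup>2) / 2)"
      by (intro mult_left_mono) (auto simp: conflict_def)
    then show "?c i j * (norm (q i) * norm (q j)) \<le> (?c i j * (norm (q i))\<^sup>2 + ?c i j * (norm (q j))\<^sup>2) / 2"
      by (simp add: distrib_left)
  qed
  also have "\<dots> = ((\<Sum>i=1..m. \<Sum>j=1..m. ?c i j * (norm (q i))\<^sup>2)
      + (\<Sum>i=1..m. \<Sum>j=1..m. ?c i j * (norm (q j))\<^sup>2)) / 2"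
    by (simp add: sum.distrib sum_divide_distrib add_divide_distrib)
  also have "(\<Sum>i=1..m. \<Sum>j=1..m. ?c i j * (norm (q j))\<^sup>2)
      = (\<Sum>i=1..m. \<Sum>j=1..m. ?c i j * (norm (q i))\<^sup>2)"
    by (subst sum.swap) (simp add: conflict_commute)
  also have "((\<Sum>i=1..m. \<Sum>j=1..m. ?c i j * (norm (q i))\<^sup>2)
      + (\<Sum>i=1..m. \<Sum>j=1..m. ?c i j * (norm (q i))\<^sup>2)) / 2
      = (\<Sum>i=1..m. (1 + conflict_degree m a i) * (norm (q i))\<^sup>2)"
    by (simp flip: sum_distrib_right add: sum_conflict del: One_nat_def)
  also have "\<dots> \<le> (\<Sum>i=1..m. (1 + Delta_max m a) * (norm (q i))\<^sup>2)"
    by (intro sum_mono mult_right_mono) (auto simp: Delta_max_def)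
  finally show ?thesis
    by (simp add: sum_distrib_left)
qed

text \<open>Cauchy-Schwarz over all pairs: the \<open>0\<close>-\<open>1\<close> matrix \<open>conflict\<close> has \<open>m (1 + Delta_ave)\<close> entries
  equal to \<open>1\<close>, and the sum of the squared products of norms factorizes.\<close>

lemma norm_sum_sq_le_Delta_ave:
  assumes "\<And>i. i \<in> {1..m} \<Longrightarrow> supp (q i) \<subseteq> supp (a i)" and "1 \<le> m"
  shows "(norm (\<Sum>i=1..m. q i))\<^sup>2
    \<le> sqrt (real m * (1 + Delta_ave m a)) * (\<Sum>i=1..m. (norm (q i))\<^sup>2)"
proof -
  let ?I = "{1..m} \<times> {1..m}"
  have "(norm (\<Sum>i=1..m. q i))\<^sup>2 \<le> (\<Sum>i=1..m. \<Sum>j=1..m. conflict a i j * (norm (q i) * norm (q j)))"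
    using assms(1) by (rule norm_sum_sq_le_conflict)
  also have "\<dots> = (\<Sum>(i, j)\<in>?I. \<bar>conflict a i j\<bar> * \<bar>norm (q i) * norm (q j)\<bar>)"
    by (simp add: sum.cartesian_product conflict_def)
  also have "\<dots> = (\<Sum>p\<in>?I. \<bar>case_prod (conflict a) p\<bar> * \<bar>norm (q (fst p)) * norm (q (snd p))\<bar>)"
    by (simp add: case_prod_beta)
  also have "\<dots> \<le> L2_set (case_prod (conflict a)) ?I
      * L2_set (\<lambda>p. norm (q (fst p)) * norm (q (snd p))) ?I"
    by (rule L2_set_mult_ineq)
  also have "L2_set (case_prod (conflict a)) ?I = sqrt (real m * (1 + Delta_ave m a))"
    unfolding L2_set_def sum_sum_conflict[OF assms(2), symmetric]
    by (simp add: sum.cartesian_product case_prod_beta conflict_def flip: power2_eq_square)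
      (rule sum.cong; simp)
  also have "L2_set (\<lambda>p. norm (q (fst p)) * norm (q (snd p))) ?I = (\<Sum>i=1..m. (norm (q i))\<^sup>2)"
  proof -
    have "(\<Sum>p\<in>?I. (norm (q (fst p)) * norm (q (snd p)))\<^sup>2) = (\<Sum>i=1..m. (norm (q i))\<^sup>2)\<^sup>2"
      by (simp add: power2_eq_square[of "\<Sum>i=_.._. _ i"] sum_product sum.cartesian_product
          case_prod_beta power_mult_distrib)
    then show ?thesis
      by (simp add: L2_set_def sum_nonneg)
  qed
  finally show ?thesis .
qed

lemma conflict_degree_nonneg: "0 \<le> conflict_degree m a i"
  by (simp add: conflict_degree_def sum_nonneg)

lemma one_le_conflict_factor:
  assumes "1 \<le> m"
  shows "1 \<le> min (sqrt (real m * (1 + Delta_ave m a))) (1 + Delta_max m a)"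
proof -
  have "0 \<le> Delta_ave m a"
    by (simp add: Delta_ave_def sum_nonneg conflict_degree_nonneg)
  then have "1 * 1 \<le> real m * (1 + Delta_ave m a)"
    using assms by (intro mult_mono) auto
  moreover have "0 \<le> Delta_max m a"
    unfolding Delta_max_def using assms
    by (intro Max_ge_iff[THEN iffD2] bexI[of _ "conflict_degree m a 1"])
      (auto simp: conflict_degree_nonneg)
  ultimately show ?thesis by simp
qed


lemma norm_sum_sq_le_conflict_factor:
  assumes "\<And>i. i \<in> {1..m} \<Longrightarrow> supp (q i) \<subseteq> supp (a i)" and "1 \<le> m"
    and "\<sigma> = min (sqrt (real m * (1 + Delta_ave m a))) (1 + Delta_max m a)"
  shows "(norm (\<Sum>i=1..m. q i))\<^sup>2 \<le> \<sigma> * (\<Sum>i=1..m. (norm (q i))\<^sup>2)"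
  using norm_sum_sq_le_Delta_ave[of m q a, OF assms(1,2)] norm_sum_sq_le_Delta_max[of m q a, OF assms(1)]
  by (simp add: assms(3) min_def del: One_nat_def)

section \<open>Square integrable random vectors\<close>

lemma integrable_inner_of_square_integrable:
  fixes U V :: "'w \<Rightarrow> 'b::euclidean_space"
  assumes [measurable]: "U \<in> borel_measurable M" "V \<in> borel_measurable M"
    and "integrable M (\<lambda>\<omega>. (norm (U \<omega>))\<^sup>2)" "integrable M (\<lambda>\<omega>. (norm (V \<omega>))\<^sup>2)"
  shows "integrable M (\<lambda>\<omega>. U \<omega> \<bullet> V \<omega>)"
proof (rule Bochner_Integration.integrable_bound)
  show "integrable M (\<lambda>\<omega>. (norm (U \<omega>))\<^sup>2 + (norm (V \<omega>))\<^sup>2)"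
    using assms(3,4) by (rule Bochner_Integration.integrable_add)
  have "\<bar>U \<omega> \<bullet> V \<omega>\<bar> \<le> (norm (U \<omega>))\<^sup>2 + (norm (V \<omega>))\<^sup>2" for \<omega>
    using Cauchy_Schwarz_ineq2[of "U \<omega>" "V \<omega>"]
      sum_squares_bound[of "norm (U \<omega>)" "norm (V \<omega>)"]
      zero_le_power2[of "norm (U \<omega>)"] zero_le_power2[of "norm (V \<omega>)"]
    by linarith
  then show "AE \<omega> in M. norm (U \<omega> \<bullet> V \<omega>) \<le> norm ((norm (U \<omega>))\<^sup>2 + (norm (V \<omega>))\<^sup>2)"
    by auto
qed measurable

lemma square_integrable_add:
  fixes U V :: "'w \<Rightarrow> 'b::euclidean_space"
  assumes [measurable]: "U \<in> borel_measurable M" "V \<in> borel_measurable M"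
    and "integrable M (\<lambda>\<omega>. (norm (U \<omega>))\<^sup>2)" "integrable M (\<lambda>\<omega>. (norm (V \<omega>))\<^sup>2)"
  shows "integrable M (\<lambda>\<omega>. (norm (U \<omega> + V \<omega>))\<^sup>2)"
proof -
  have "(norm (U \<omega> + V \<omega>))\<^sup>2 = (norm (U \<omega>))\<^sup>2 + 2 * (U \<omega> \<bullet> V \<omega>) + (norm (V \<omega>))\<^sup>2" for \<omega>
    by (simp add: power2_norm_eq_inner inner_add_left inner_add_right inner_commute)
  then show ?thesis
    using assms integrable_inner_of_square_integrable[OF assms] by simp
qed

lemma square_integrable_scaleR:
  fixes U :: "'w \<Rightarrow> 'b::euclidean_space"
  assumes "integrable M (\<lambda>\<omega>. (norm (U \<omega>))\<^sup>2)"
  shows "integrable M (\<lambda>\<omega>. (norm (c *\<^sub>R U \<omega>))\<^sup>2)"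
  using assms by (simp add: power_mult_distrib)

lemma square_integrable_sum:
  fixes U :: "'i \<Rightarrow> 'w \<Rightarrow> 'b::euclidean_space"
  assumes "finite I" and "\<And>i. i \<in> I \<Longrightarrow> U i \<in> borel_measurable M"
    and "\<And>i. i \<in> I \<Longrightarrow> integrable M (\<lambda>\<omega>. (norm (U i \<omega>))\<^sup>2)"
  shows "integrable M (\<lambda>\<omega>. (norm (\<Sum>i\<in>I. U i \<omega>))\<^sup>2)"
  using assms
  by (induction I) (auto intro!: square_integrable_add)

lemma (in prob_space) square_integrable_lipschitz:
  fixes X :: "'a \<Rightarrow> 'b::euclidean_space" and g :: "'b \<Rightarrow> 'c::euclidean_space"
  assumes [measurable]: "X \<in> borel_measurable M" and g: "L-lipschitz_on UNIV g"
    and X: "integrable M (\<lambda>\<omega>. (norm (X \<omega> - c))\<^sup>2)"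
  shows "integrable M (\<lambda>\<omega>. (norm (g (X \<omega>)))\<^sup>2)"
proof -
  have [measurable]: "g \<in> borel_measurable borel"
    using g by (intro borel_measurable_continuous_onI lipschitz_on_continuous_on)
  have "integrable M (\<lambda>\<omega>. (norm (g (X \<omega>) - g c))\<^sup>2)"
  proof (rule Bochner_Integration.integrable_bound)
    show "integrable M (\<lambda>\<omega>. L\<^sup>2 * (norm (X \<omega> - c))\<^sup>2)"
      using X by simp
    have "(norm (g (X \<omega>) - g c))\<^sup>2 \<le> (L * norm (X \<omega> - c))\<^sup>2" for \<omega>
      using lipschitz_onD[OF g, of "X \<omega>" c] by (intro power_mono) (auto simp: dist_norm)
    then show "AE \<omega> in M. norm ((norm (g (X \<omega>) - g c))\<^sup>2) \<le> norm (L\<^sup>2 * (norm (X \<omega> - c))\<^sup>2)"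
      by (auto simp: power_mult_distrib)
  qed measurable
  then have "integrable M (\<lambda>\<omega>. (norm ((g (X \<omega>) - g c) + g c))\<^sup>2)"
    by (intro square_integrable_add) auto
  then show ?thesis by simp
qed

section \<open>Quantization with an independent seed\<close>

lemma measurable_quantizer:
  assumes "unbiased_random_quantizer \<alpha> N Q"
    and [measurable]: "S \<in> measurable K N" "V \<in> borel_measurable K"
  shows "(\<lambda>\<omega>. Q (S \<omega>) (V \<omega>)) \<in> borel_measurable K"
proof -
  have [measurable]: "(\<lambda>(s, v). Q s v) \<in> borel_measurable (N \<Otimes>\<^sub>M borel)"
    using assms(1) by (simp add: unbiased_random_quantizer_def)
  have "(\<lambda>\<omega>. (\<lambda>(s, v). Q s v) (S \<omega>, V \<omega>)) \<in> borel_measurable K"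
    by measurable
  then show ?thesis by simp
qed

text \<open>In the following, \<open>X\<close> is a random point independent of the seed \<open>\<xi>\<close>, and the seed has law \<open>N\<close>;
  both are expressed by the law of the pair.\<close>

context
  fixes M :: "'w measure" and N :: "'s measure" and \<xi> :: "'w \<Rightarrow> 's"
    and X :: "'w \<Rightarrow> 'b::euclidean_space" and Q :: "'s \<Rightarrow> real ^ 'd \<Rightarrow> real ^ 'd"
    and \<alpha> :: real and g :: "'b \<Rightarrow> real ^ 'd"
  assumes M: "prob_space M"
    and Q: "unbiased_random_quantizer \<alpha> N Q"
    and X_measurable [measurable]: "X \<in> borel_measurable M"
    and \<xi>_measurable [measurable]: "\<xi> \<in> measurable M N"
    and distr_pair: "distr M (borel \<Otimes>\<^sub>M N) (\<lambda>\<omega>. (X \<omega>, \<xi> \<omega>)) = distr M borel X \<Otimes>\<^sub>M N"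
    and g_measurable [measurable]: "g \<in> borel_measurable borel"
begin

interpretation M: prob_space M by (rule M)

interpretation N: prob_space N
  using Q by (simp add: unbiased_random_quantizer_def)

interpretation X: prob_space "distr M borel X"
  by (rule M.prob_space_distr) measurable

interpretation XN: pair_prob_space "distr M borel X" N ..

lemma measurable_quantized [measurable]:
  "(\<lambda>p. Q (snd p) (g (fst p))) \<in> borel_measurable (borel \<Otimes>\<^sub>M N)"
  "(\<lambda>p. Q (snd p) (g (fst p))) \<in> borel_measurable (distr M borel X \<Otimes>\<^sub>M N)"
  "(\<lambda>\<omega>. Q (\<xi> \<omega>) (g (X \<omega>))) \<in> borel_measurable M"
  by (rule measurable_quantizer[OF Q]; measurable)+

text \<open>The exceptional null set of seeds may depend on the quantized vector; independence makes the
  union over the values of \<open>X\<close> negligible, provided that the event is measurable.\<close>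

lemma quantizer_supp:
  "AE \<omega> in M. supp (Q (\<xi> \<omega>) (g (X \<omega>))) \<subseteq> supp (g (X \<omega>))"
proof -
  let ?P = "\<lambda>p. supp (Q (snd p) (g (fst p))) \<subseteq> supp (g (fst p))"
  have nth [measurable]: "(\<lambda>v::real^'d. v $ i) \<in> borel_measurable borel" for i
    by (intro borel_measurable_continuous_onI continuous_intros)
  have "?P p \<longleftrightarrow> (\<forall>i\<in>UNIV. Q (snd p) (g (fst p)) $ i = 0 \<or> g (fst p) $ i \<noteq> 0)" for p
    by (auto simp: supp_def)
  then have meas: "{p \<in> space (borel \<Otimes>\<^sub>M N). ?P p} \<in> sets (borel \<Otimes>\<^sub>M N)"
    by simp measurable
  have "AE p in distr M borel X \<Otimes>\<^sub>M N. ?P p"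
  proof (rule XN.AE_pair_measure)
    show "{p \<in> space (distr M borel X \<Otimes>\<^sub>M N). ?P p} \<in> sets (distr M borel X \<Otimes>\<^sub>M N)"
      using meas by (simp add: space_pair_measure cong: sets_pair_measure_cong)
    show "AE y in distr M borel X. AE s in N. ?P (y, s)"
      using Q by (simp add: unbiased_random_quantizer_def)
  qed
  then show ?thesis
    unfolding distr_pair[symmetric] by (subst (asm) AE_distr_iff) (use meas in auto)
qed

lemma quantizer_second_moment:
  assumes "integrable M (\<lambda>\<omega>. (norm (g (X \<omega>)))\<^sup>2)"
  shows "integrable M (\<lambda>\<omega>. (norm (Q (\<xi> \<omega>) (g (X \<omega>))))\<^sup>2)"
    and "(\<integral>\<omega>. (norm (Q (\<xi> \<omega>) (g (X \<omega>))))\<^sup>2 \<partial>M) \<le> \<alpha> * (\<integral>\<omega>. (norm (g (X \<omega>)))\<^sup>2 \<partial>M)"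
proof -
  let ?h = "\<lambda>p. (norm (Q (snd p) (g (fst p))))\<^sup>2"
  have moment: "integrable N (\<lambda>s. (norm (Q s v))\<^sup>2)"
    "(\<integral>s. (norm (Q s v))\<^sup>2 \<partial>N) \<le> \<alpha> * (norm v)\<^sup>2" for v
    using Q by (auto simp: unbiased_random_quantizer_def)
  have g: "integrable (distr M borel X) (\<lambda>y. (norm (g y))\<^sup>2)"
    using assms by (subst integrable_distr_eq) auto
  have bound: "integrable (distr M borel X) (\<lambda>y. \<integral>s. ?h (y, s) \<partial>N)"
  proof (rule Bochner_Integration.integrable_bound)
    show "integrable (distr M borel X) (\<lambda>y. \<alpha> * (norm (g y))\<^sup>2)"
      using g by simp
    show "AE y in distr M borel X. norm (\<integral>s. ?h (y, s) \<partial>N) \<le> norm (\<alpha> * (norm (g y))\<^sup>2)"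
      using moment(2) by (auto intro!: AE_I2 order_trans[OF _ abs_ge_self])
    show "(\<lambda>y. \<integral>s. ?h (y, s) \<partial>N) \<in> borel_measurable (distr M borel X)"
      by (intro N.borel_measurable_lebesgue_integral) measurable
  qed
  have int: "integrable (distr M borel X \<Otimes>\<^sub>M N) ?h"
    using bound moment(1) by (intro XN.Fubini_integrable) auto
  then have "integrable (distr M (borel \<Otimes>\<^sub>M N) (\<lambda>\<omega>. (X \<omega>, \<xi> \<omega>))) ?h"
    by (simp only: distr_pair)
  then show "integrable M (\<lambda>\<omega>. (norm (Q (\<xi> \<omega>) (g (X \<omega>))))\<^sup>2)"
    by (subst (asm) integrable_distr_eq) auto
  have "(\<integral>\<omega>. (norm (Q (\<xi> \<omega>) (g (X \<omega>))))\<^sup>2 \<partial>M)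
      = integral\<^sup>L (distr M (borel \<Otimes>\<^sub>M N) (\<lambda>\<omega>. (X \<omega>, \<xi> \<omega>))) ?h"
    by (subst integral_distr) auto
  also have "\<dots> = (\<integral>y. \<integral>s. ?h (y, s) \<partial>N \<partial>distr M borel X)"
    unfolding distr_pair using int by (rule XN.integral_fst'[symmetric])
  also have "\<dots> \<le> (\<integral>y. \<alpha> * (norm (g y))\<^sup>2 \<partial>distr M borel X)"
    using bound g moment(2) by (intro integral_mono) auto
  also have "\<dots> = \<alpha> * (\<integral>\<omega>. (norm (g (X \<omega>)))\<^sup>2 \<partial>M)"
    by (subst integral_distr) auto
  finally show "(\<integral>\<omega>. (norm (Q (\<xi> \<omega>) (g (X \<omega>))))\<^sup>2 \<partial>M) \<le> \<alpha> * (\<integral>\<omega>. (norm (g (X \<omega>)))\<^sup>2 \<partial>M)" .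
qed

text \<open>The inner product is integrable over the joint law because both factors are square integrable.
  Hence the seed may be integrated out first, which replaces \<open>Q\<close> by the identity.\<close>

lemma quantizer_unbiased:
  assumes [measurable]: "h \<in> borel_measurable borel"
    and g: "integrable M (\<lambda>\<omega>. (norm (g (X \<omega>)))\<^sup>2)"
    and h: "integrable M (\<lambda>\<omega>. (norm (h (X \<omega>)))\<^sup>2)"
  shows "integrable M (\<lambda>\<omega>. Q (\<xi> \<omega>) (g (X \<omega>)) \<bullet> h (X \<omega>))"
    and "(\<integral>\<omega>. Q (\<xi> \<omega>) (g (X \<omega>)) \<bullet> h (X \<omega>) \<partial>M) = (\<integral>\<omega>. g (X \<omega>) \<bullet> h (X \<omega>) \<partial>M)"
proof -
  let ?q = "\<lambda>p. Q (snd p) (g (fst p)) \<bullet> h (fst p)"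
  show int: "integrable M (\<lambda>\<omega>. Q (\<xi> \<omega>) (g (X \<omega>)) \<bullet> h (X \<omega>))"
    using quantizer_second_moment(1)[OF g] h
    by (intro integrable_inner_of_square_integrable) auto
  have "integrable (distr M (borel \<Otimes>\<^sub>M N) (\<lambda>\<omega>. (X \<omega>, \<xi> \<omega>))) ?q"
    using int by (subst integrable_distr_eq) auto
  then have int': "integrable (distr M borel X \<Otimes>\<^sub>M N) ?q"
    by (simp only: distr_pair)
  have mean: "integrable N (\<lambda>s. Q s v)" "(\<integral>s. Q s v \<partial>N) = v" for v
    using Q by (auto simp: unbiased_random_quantizer_def)
  have "(\<integral>\<omega>. Q (\<xi> \<omega>) (g (X \<omega>)) \<bullet> h (X \<omega>) \<partial>M)
      = integral\<^sup>L (distr M (borel \<Otimes>\<^sub>M N) (\<lambda>\<omega>. (X \<omega>, \<xi> \<omega>))) ?q"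
    by (subst integral_distr) auto
  also have "\<dots> = (\<integral>y. \<integral>s. ?q (y, s) \<partial>N \<partial>distr M borel X)"
    unfolding distr_pair using int' by (rule XN.integral_fst'[symmetric])
  also have "\<dots> = (\<integral>y. g y \<bullet> h y \<partial>distr M borel X)"
    using mean by simp
  also have "\<dots> = (\<integral>\<omega>. g (X \<omega>) \<bullet> h (X \<omega>) \<partial>M)"
    by (subst integral_distr) auto
  finally show "(\<integral>\<omega>. Q (\<xi> \<omega>) (g (X \<omega>)) \<bullet> h (X \<omega>) \<partial>M) = (\<integral>\<omega>. g (X \<omega>) \<bullet> h (X \<omega>) \<partial>M)" .
qed

end

section \<open>One iteration\<close>

text \<open>The conflict graph is applied before taking expectations: it removes the mixed products of
  quantized gradients almost surely, so that every term left to integrate involves a single seed, which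
  is independent of \<open>X\<close>.\<close>

lemma expected_squared_distance_step:
  fixes M :: "'w measure" and N :: "'s measure" and \<xi> :: "nat \<Rightarrow> 'w \<Rightarrow> 's"
    and X :: "'w \<Rightarrow> real ^ 'd" and g :: "nat \<Rightarrow> real ^ 'd \<Rightarrow> real ^ 'd"
  assumes M: "prob_space M" and Q: "unbiased_random_quantizer \<alpha> N Q"
    and X [measurable]: "X \<in> borel_measurable M"
    and \<xi>: "\<And>i. i \<in> {1..m} \<Longrightarrow> \<xi> i \<in> measurable M N"
    and fresh: "\<And>i. i \<in> {1..m} \<Longrightarrow>
      distr M (borel \<Otimes>\<^sub>M N) (\<lambda>\<omega>. (X \<omega>, \<xi> i \<omega>)) = distr M borel X \<Otimes>\<^sub>M N"
    and g: "\<And>i. i \<in> {1..m} \<Longrightarrow> L-lipschitz_on UNIV (g i)"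
    and supp_g: "\<And>i y. i \<in> {1..m} \<Longrightarrow> supp (g i y) \<subseteq> supp (a i)"
    and m: "1 \<le> m"
    and \<sigma>: "\<sigma> = min (sqrt (real m * (1 + Delta_ave m a))) (1 + Delta_max m a)"
    and X_L2: "integrable M (\<lambda>\<omega>. (norm (X \<omega> - z))\<^sup>2)"
  shows "integrable M (\<lambda>\<omega>. (norm (X \<omega> - \<gamma> *\<^sub>R (\<Sum>i=1..m. Q (\<xi> i \<omega>) (g i (X \<omega>))) - z))\<^sup>2)"
      (is "integrable M ?next")
    and "integrable M (\<lambda>\<omega>. \<gamma>\<^sup>2 * (\<sigma> * \<alpha>) * (\<Sum>i=1..m. (norm (g i (X \<omega>)))\<^sup>2)
        - 2 * \<gamma> * (\<Sum>i=1..m. g i (X \<omega>) \<bullet> (X \<omega> - z)))" (is "integrable M ?drift")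
    and "(\<integral>\<omega>. (norm (X \<omega> - \<gamma> *\<^sub>R (\<Sum>i=1..m. Q (\<xi> i \<omega>) (g i (X \<omega>))) - z))\<^sup>2 \<partial>M)
      \<le> (\<integral>\<omega>. (norm (X \<omega> - z))\<^sup>2 \<partial>M)
        + (\<integral>\<omega>. \<gamma>\<^sup>2 * (\<sigma> * \<alpha>) * (\<Sum>i=1..m. (norm (g i (X \<omega>)))\<^sup>2)
            - 2 * \<gamma> * (\<Sum>i=1..m. g i (X \<omega>) \<bullet> (X \<omega> - z)) \<partial>M)"
proof -
  interpret prob_space M by (rule M)
  let ?I = "{1..m}"
  define D where "D \<omega> = X \<omega> - z" for \<omega>
  define q where "q i \<omega> = Q (\<xi> i \<omega>) (g i (X \<omega>))" for i \<omega>
  have [measurable]: "D \<in> borel_measurable M"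
    unfolding D_def by measurable
  have D_L2: "integrable M (\<lambda>\<omega>. (norm (D \<omega>))\<^sup>2)"
    using X_L2 by (simp add: D_def)
  have g_meas: "g i \<in> borel_measurable borel" if "i \<in> ?I" for i
    using g[OF that] by (intro borel_measurable_continuous_onI lipschitz_on_continuous_on)
  have g_L2: "integrable M (\<lambda>\<omega>. (norm (g i (X \<omega>)))\<^sup>2)" if "i \<in> ?I" for i
    using X g[OF that] X_L2 by (rule square_integrable_lipschitz)
  have gD: "integrable M (\<lambda>\<omega>. g i (X \<omega>) \<bullet> D \<omega>)" if "i \<in> ?I" for i
    using g_meas[OF that] g_L2[OF that] D_L2
    by (intro integrable_inner_of_square_integrable) auto
  note quantized = M Q X \<xi> fresh g_meas
  have q_meas: "q i \<in> borel_measurable M" if "i \<in> ?I" for i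
    using measurable_quantized(3)[OF quantized] that by (simp add: q_def[abs_def])
  have q_L2: "integrable M (\<lambda>\<omega>. (norm (q i \<omega>))\<^sup>2)"
    and q_moment: "(\<integral>\<omega>. (norm (q i \<omega>))\<^sup>2 \<partial>M) \<le> \<alpha> * (\<integral>\<omega>. (norm (g i (X \<omega>)))\<^sup>2 \<partial>M)"
    if "i \<in> ?I" for i
    using quantizer_second_moment[OF quantized] that g_L2 by (simp_all add: q_def)
  have qD: "integrable M (\<lambda>\<omega>. q i \<omega> \<bullet> D \<omega>)"
    and q_mean: "(\<integral>\<omega>. q i \<omega> \<bullet> D \<omega> \<partial>M) = (\<integral>\<omega>. g i (X \<omega>) \<bullet> D \<omega> \<partial>M)" if "i \<in> ?I" for i
    using quantizer_unbiased[OF M Q X \<xi>[OF that] fresh[OF that] g_meas[OF that],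
        of "\<lambda>y. y - z"] that g_L2 X_L2
    by (simp_all add: q_def D_def)
  have q_supp: "AE \<omega> in M. \<forall>i\<in>?I. supp (q i \<omega>) \<subseteq> supp (a i)"
  proof (intro AE_finite_allI)
    fix i assume i: "i \<in> ?I"
    then have "AE \<omega> in M. supp (q i \<omega>) \<subseteq> supp (g i (X \<omega>))"
      unfolding q_def by (intro quantizer_supp[OF quantized])
    then show "AE \<omega> in M. supp (q i \<omega>) \<subseteq> supp (a i)"
      by eventually_elim (use supp_g[OF i] in blast)
  qed simp
  have next_eq: "?next = (\<lambda>\<omega>. (norm (D \<omega> + (- \<gamma>) *\<^sub>R (\<Sum>i\<in>?I. q i \<omega>)))\<^sup>2)"
    by (simp add: D_def q_def algebra_simps)
  show next_int: "integrable M ?next"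
    unfolding next_eq using q_meas q_L2 D_L2
    by (intro square_integrable_add square_integrable_scaleR square_integrable_sum) auto
  show drift_int: "integrable M ?drift"
    using g_L2 gD unfolding D_def
    by (intro Bochner_Integration.integrable_diff integrable_mult_right
        Bochner_Integration.integrable_sum)
  (* R bounds the squared distance after the step almost surely; A and B are its random inner products
     and second moments, and A' and B' are the same quantities without quantization. *)
  define A where "A \<omega> = (\<Sum>i\<in>?I. q i \<omega> \<bullet> D \<omega>)" for \<omega>
  define B where "B \<omega> = (\<Sum>i\<in>?I. (norm (q i \<omega>))\<^sup>2)" for \<omega>
  define A' where "A' \<omega> = (\<Sum>i\<in>?I. g i (X \<omega>) \<bullet> D \<omega>)" for \<omega>
  define B' where "B' \<omega> = (\<Sum>i\<in>?I. (norm (g i (X \<omega>)))\<^sup>2)" for \<omega>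
  have int: "integrable M A" "integrable M B" "integrable M A'" "integrable M B'"
    unfolding A_def B_def A'_def B'_def using qD q_L2 gD g_L2
    by (intro Bochner_Integration.integrable_sum; blast)+
  have A_mean: "(\<integral>\<omega>. A \<omega> \<partial>M) = (\<integral>\<omega>. A' \<omega> \<partial>M)"
    unfolding A_def A'_def using qD gD q_mean by (simp add: Bochner_Integration.integral_sum)
  have "(\<integral>\<omega>. B \<omega> \<partial>M) = (\<Sum>i\<in>?I. \<integral>\<omega>. (norm (q i \<omega>))\<^sup>2 \<partial>M)"
    unfolding B_def using q_L2 by (rule Bochner_Integration.integral_sum)
  also have "\<dots> \<le> (\<Sum>i\<in>?I. \<alpha> * (\<integral>\<omega>. (norm (g i (X \<omega>)))\<^sup>2 \<partial>M))"
    by (intro sum_mono q_moment)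
  also have "\<dots> = \<alpha> * (\<integral>\<omega>. B' \<omega> \<partial>M)"
    unfolding B'_def sum_distrib_left[symmetric]
    by (subst Bochner_Integration.integral_sum) (use g_L2 in auto)
  finally have B_moment: "(\<integral>\<omega>. B \<omega> \<partial>M) \<le> \<alpha> * (\<integral>\<omega>. B' \<omega> \<partial>M)" .
  define R where "R \<omega> = (norm (D \<omega>))\<^sup>2 - 2 * \<gamma> * A \<omega> + \<gamma>\<^sup>2 * \<sigma> * B \<omega>" for \<omega>
  have R_int: "integrable M R"
    unfolding R_def using D_L2 int by simp
  have "(\<integral>\<omega>. ?next \<omega> \<partial>M) \<le> (\<integral>\<omega>. R \<omega> \<partial>M)"
  proof (rule integral_mono_AE[OF next_int R_int])
    show "AE \<omega> in M. ?next \<omega> \<le> R \<omega>"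
      using q_supp
    proof eventually_elim
      fix \<omega> assume "\<forall>i\<in>?I. supp (q i \<omega>) \<subseteq> supp (a i)"
      then have "(norm (\<Sum>i\<in>?I. q i \<omega>))\<^sup>2 \<le> \<sigma> * (\<Sum>i\<in>?I. (norm (q i \<omega>))\<^sup>2)"
        by (intro norm_sum_sq_le_conflict_factor[OF _ m \<sigma>]) auto
      then have "\<gamma>\<^sup>2 * (norm (\<Sum>i\<in>?I. q i \<omega>))\<^sup>2 \<le> \<gamma>\<^sup>2 * (\<sigma> * (\<Sum>i\<in>?I. (norm (q i \<omega>))\<^sup>2))"
        by (intro mult_left_mono) auto
      moreover have "?next \<omega> = (norm (D \<omega>))\<^sup>2 - 2 * \<gamma> * ((\<Sum>i\<in>?I. q i \<omega>) \<bullet> D \<omega>)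
          + \<gamma>\<^sup>2 * (norm (\<Sum>i\<in>?I. q i \<omega>))\<^sup>2"
        unfolding fun_cong[OF next_eq, of \<omega>]
        by (simp add: power2_norm_eq_inner inner_diff_left inner_diff_right inner_commute
            algebra_simps) (simp add: power2_eq_square)
      ultimately show "?next \<omega> \<le> R \<omega>"
        by (simp add: R_def A_def B_def inner_sum_left)
    qed
  qed
  also have "(\<integral>\<omega>. R \<omega> \<partial>M) = (\<integral>\<omega>. (norm (D \<omega>))\<^sup>2 \<partial>M)
      - 2 * \<gamma> * (\<integral>\<omega>. A' \<omega> \<partial>M) + \<gamma>\<^sup>2 * \<sigma> * (\<integral>\<omega>. B \<omega> \<partial>M)"
    unfolding R_def A_mean[symmetric] using D_L2 int by simp
  also have "\<dots> \<le> (\<integral>\<omega>. (norm (D \<omega>))\<^sup>2 \<partial>M)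
      - 2 * \<gamma> * (\<integral>\<omega>. A' \<omega> \<partial>M) + \<gamma>\<^sup>2 * \<sigma> * (\<alpha> * (\<integral>\<omega>. B' \<omega> \<partial>M))"
  proof -
    have "1 \<le> \<sigma>"
      unfolding \<sigma> by (rule one_le_conflict_factor[OF m])
    then show ?thesis
      using B_moment by (intro add_left_mono mult_left_mono) auto
  qed
  also have "\<dots> = (\<integral>\<omega>. (norm (D \<omega>))\<^sup>2 \<partial>M)
      + (\<integral>\<omega>. \<gamma>\<^sup>2 * (\<sigma> * \<alpha>) * B' \<omega> - 2 * \<gamma> * A' \<omega> \<partial>M)"
    using int by simp
  finally show "(\<integral>\<omega>. ?next \<omega> \<partial>M) \<le> (\<integral>\<omega>. (norm (X \<omega> - z))\<^sup>2 \<partial>M) + (\<integral>\<omega>. ?drift \<omega> \<partial>M)"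
    unfolding D_def A'_def B'_def .
qed

section \<open>Independence of iterates and fresh seeds\<close>

text \<open>The notion \<open>indep_var\<close> relates only random variables of one type. Independence of an iterate
  and a seed, which have different types, is therefore expressed by a product law; it is obtained
  from two families of seeds, of the same type, of which the iterate and the seed are functions.\<close>

lemma (in prob_space) distr_pair_compose_indep:
  assumes indep: "indep_var S U T V"
    and f: "f \<in> measurable S S'" and g: "g \<in> measurable T T'"
  shows "distr M (S' \<Otimes>\<^sub>M T') (\<lambda>\<omega>. (f (U \<omega>), g (V \<omega>)))
    = distr M S' (\<lambda>\<omega>. f (U \<omega>)) \<Otimes>\<^sub>M distr M T' (\<lambda>\<omega>. g (V \<omega>))"
proof -
  have UV [measurable]: "U \<in> measurable M S" "V \<in> measurable M T"
    and distr: "distr M S U \<Otimes>\<^sub>M distr M T V = distr M (S \<Otimes>\<^sub>M T) (\<lambda>\<omega>. (U \<omega>, V \<omega>))"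
    using indep by (simp_all add: indep_var_distribution_eq)
  note [measurable] = f g
  interpret gV: prob_space "distr (distr M T V) T' g"
    by (intro prob_space.prob_space_distr prob_space_distr) measurable
  have "distr M S' (\<lambda>\<omega>. f (U \<omega>)) \<Otimes>\<^sub>M distr M T' (\<lambda>\<omega>. g (V \<omega>))
      = distr (distr M S U) S' f \<Otimes>\<^sub>M distr (distr M T V) T' g"
    by (simp add: distr_distr comp_def)
  also have "\<dots> = distr (distr M S U \<Otimes>\<^sub>M distr M T V) (S' \<Otimes>\<^sub>M T') (\<lambda>(u, v). (f u, g v))"
    by (rule pair_measure_distr) (simp_all add: gV.sigma_finite_measure_axioms)
  also have "\<dots> = distr M (S' \<Otimes>\<^sub>M T') (\<lambda>\<omega>. (f (U \<omega>), g (V \<omega>)))"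
    unfolding distr by (simp add: distr_distr comp_def)
  finally show ?thesis ..
qed

text \<open>The restriction to the index set of the past seeds, rather than a function of all seeds, is what
  makes independence of the seeds in iteration \<open>k\<close> available.\<close>

lemma iterate_function_of_past_seeds:
  fixes x :: "nat \<Rightarrow> 'w \<Rightarrow> real ^ 'd"
  assumes Q: "unbiased_random_quantizer \<alpha> N Q"
    and g: "\<And>i. i \<in> {1..m} \<Longrightarrow> g i \<in> borel_measurable borel"
    and init: "\<And>\<omega>. \<omega> \<in> \<Omega> \<Longrightarrow> x 0 \<omega> = x0"
    and step: "\<And>k \<omega>. \<omega> \<in> \<Omega> \<Longrightarrow>
      x (Suc k) \<omega> = x k \<omega> - \<gamma> *\<^sub>R (\<Sum>i=1..m. Q (\<xi> k i \<omega>) (g i (x k \<omega>)))"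
  shows "\<exists>h \<in> borel_measurable (\<Pi>\<^sub>M p\<in>{..<k} \<times> {1..m}. N).
    \<forall>\<omega>\<in>\<Omega>. x k \<omega> = h (\<lambda>p\<in>{..<k} \<times> {1..m}. (\<lambda>(k, i). \<xi> k i) p \<omega>)"
proof (induction k)
  case 0
  show ?case
    using init by (intro bexI[of _ "\<lambda>_. x0"]) auto
next
  case (Suc k)
  let ?A = "\<lambda>k. {..<k} \<times> {1..m}"
  let ?P = "\<lambda>k. \<Pi>\<^sub>M p\<in>?A k. N"
  from Suc obtain h where h: "h \<in> borel_measurable (?P k)"
    and x: "\<And>\<omega>. \<omega> \<in> \<Omega> \<Longrightarrow> x k \<omega> = h (\<lambda>p\<in>?A k. (\<lambda>(k, i). \<xi> k i) p \<omega>)"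
    by blast
  define h' where "h' s = h (restrict s (?A k))
      - \<gamma> *\<^sub>R (\<Sum>i=1..m. Q (s (k, i)) (g i (h (restrict s (?A k)))))" for s
  have past: "(\<lambda>s. h (restrict s (?A k))) \<in> borel_measurable (?P (Suc k))"
    by (rule measurable_compose[OF measurable_restrict_subset h]) auto
  have seed: "(\<lambda>s. s (k, i)) \<in> measurable (?P (Suc k)) N" if "i \<in> {1..m}" for i
    using that by (intro measurable_component_singleton) auto
  have "h' \<in> borel_measurable (?P (Suc k))"
    unfolding h'_def using past seed
    by (intro borel_measurable_diff borel_measurable_scaleR borel_measurable_sum
        measurable_quantizer[OF Q] measurable_compose[OF past g] measurable_const) auto
  moreover have "x (Suc k) \<omega> = h' (\<lambda>p\<in>?A (Suc k). (\<lambda>(k, i). \<xi> k i) p \<omega>)" if "\<omega> \<in> \<Omega>" for \<omega>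
  proof -
    have "?A (Suc k) \<inter> ?A k = ?A k" by auto
    then show ?thesis
      using that by (simp add: h'_def step x)
  qed
  ultimately show ?case by blast
qed

lemma iterate_independent_of_fresh_seed:
  fixes x :: "nat \<Rightarrow> 'w \<Rightarrow> real ^ 'd"
  assumes M: "prob_space M" and Q: "unbiased_random_quantizer \<alpha> N Q"
    and g: "\<And>i. i \<in> {1..m} \<Longrightarrow> g i \<in> borel_measurable borel"
    and seeds: "fresh_seeds M N m \<xi>"
    and init: "\<And>\<omega>. \<omega> \<in> space M \<Longrightarrow> x 0 \<omega> = x0"
    and step: "\<And>k \<omega>. \<omega> \<in> space M \<Longrightarrow>
      x (Suc k) \<omega> = x k \<omega> - \<gamma> *\<^sub>R (\<Sum>i=1..m. Q (\<xi> k i \<omega>) (g i (x k \<omega>)))"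
    and i: "i \<in> {1..m}"
  shows "x k \<in> borel_measurable M" and "\<xi> k i \<in> measurable M N"
    and "distr M (borel \<Otimes>\<^sub>M N) (\<lambda>\<omega>. (x k \<omega>, \<xi> k i \<omega>)) = distr M borel (x k) \<Otimes>\<^sub>M N"
proof -
  interpret prob_space M by (rule M)
  let ?A = "{..<k} \<times> {1..m}" and ?B = "{(k, i)}"
  let ?S = "\<lambda>p \<omega>. (\<lambda>(k, i). \<xi> k i) p \<omega>"
  from iterate_function_of_past_seeds[where \<Omega> = "space M" and x = x, OF Q g init step]
  obtain h where h: "h \<in> borel_measurable (\<Pi>\<^sub>M p\<in>?A. N)"
    and x: "\<And>\<omega>. \<omega> \<in> space M \<Longrightarrow> x k \<omega> = h (\<lambda>p\<in>?A. ?S p \<omega>)"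
    by blast
  have "indep_vars (\<lambda>_. N) ?S (UNIV \<times> {1..m})"
    using seeds by (simp add: fresh_seeds_def)
  then have indep: "indep_var (\<Pi>\<^sub>M p\<in>?A. N) (\<lambda>\<omega>. \<lambda>p\<in>?A. ?S p \<omega>)
      (\<Pi>\<^sub>M p\<in>?B. N) (\<lambda>\<omega>. \<lambda>p\<in>?B. ?S p \<omega>)"
    using i by (intro indep_var_restrict) auto
  have h_meas: "(\<lambda>\<omega>. h (\<lambda>p\<in>?A. ?S p \<omega>)) \<in> borel_measurable M"
    using indep_var_rv1[OF indep] h by (rule measurable_compose)
  then show "x k \<in> borel_measurable M"
    by (simp add: x cong: measurable_cong)
  have component: "(\<lambda>s. s (k, i)) \<in> measurable (\<Pi>\<^sub>M p\<in>?B. N) N"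
    by (rule measurable_component_singleton) simp
  show "\<xi> k i \<in> measurable M N"
    using measurable_compose[OF indep_var_rv2[OF indep] component] by simp
  have "distr M (borel \<Otimes>\<^sub>M N) (\<lambda>\<omega>. (x k \<omega>, \<xi> k i \<omega>))
      = distr M (borel \<Otimes>\<^sub>M N) (\<lambda>\<omega>. (h (\<lambda>p\<in>?A. ?S p \<omega>), (\<lambda>p\<in>?B. ?S p \<omega>) (k, i)))"
    by (rule distr_cong) (auto simp: x)
  also have "\<dots> = distr M borel (\<lambda>\<omega>. h (\<lambda>p\<in>?A. ?S p \<omega>)) \<Otimes>\<^sub>M distr M N (\<lambda>\<omega>. (\<lambda>p\<in>?B. ?S p \<omega>) (k, i))"
    using indep h component by (rule distr_pair_compose_indep)
  also have "distr M borel (\<lambda>\<omega>. h (\<lambda>p\<in>?A. ?S p \<omega>)) = distr M borel (x k)"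
    by (rule distr_cong) (auto simp: x)
  also have "distr M N (\<lambda>\<omega>. (\<lambda>p\<in>?B. ?S p \<omega>) (k, i)) = N"
    using seeds i by (simp add: fresh_seeds_def)
  finally show "distr M (borel \<Otimes>\<^sub>M N) (\<lambda>\<omega>. (x k \<omega>, \<xi> k i \<omega>)) = distr M borel (x k) \<Otimes>\<^sub>M N" .
qed

section \<open>Convergence of the averaged iterates\<close>

theorem theorem5p3:
  fixes M :: "'w measure" and N :: "'s measure"
    and m T :: nat and L \<alpha> \<theta> \<gamma> \<sigma> :: real
    and F :: "real ^ 'd \<Rightarrow> real"
    and f :: "nat \<Rightarrow> real ^ 'd \<Rightarrow> real"
    and gradf :: "nat \<Rightarrow> real ^ 'd \<Rightarrow> real ^ 'd"
    and \<l> :: "real \<Rightarrow> real \<Rightarrow> real"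
    and a :: "nat \<Rightarrow> real ^ 'd" and b :: "nat \<Rightarrow> real"
    and Q :: "'s \<Rightarrow> real ^ 'd \<Rightarrow> real ^ 'd"
    and \<xi> :: "nat \<Rightarrow> nat \<Rightarrow> 'w \<Rightarrow> 's"
    and x :: "nat \<Rightarrow> 'w \<Rightarrow> real ^ 'd"
    and x0 xstar :: "real ^ 'd"
  assumes m: "1 \<le> m"
    and L: "0 < L"
    and F: "F = (\<lambda>y. \<Sum>i=1..m. f i y)"
    and gradient: "\<And>i y. i \<in> {1..m} \<Longrightarrow> GDERIV (f i) y :> gradf i y"
    and convex: "\<And>i. i \<in> {1..m} \<Longrightarrow> convex_on UNIV (f i)"
    and smooth: "\<And>i. i \<in> {1..m} \<Longrightarrow> L-lipschitz_on UNIV (gradf i)"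
    and loss: "\<And>i y. i \<in> {1..m} \<Longrightarrow> f i y = \<l> (a i \<bullet> y) (b i)"
    and supp_gradient: "\<And>i y. i \<in> {1..m} \<Longrightarrow> supp (gradf i y) = supp (a i)"
    and minimizer: "\<And>y. F xstar \<le> F y"
    and \<sigma>: "\<sigma> = min (sqrt (real m * (1 + Delta_ave m a))) (1 + Delta_max m a)"
    and \<theta>: "0 < \<theta>"
    and quantizer: "unbiased_random_quantizer \<alpha> N Q"
    and \<gamma>: "\<gamma> = 1 / (L * \<alpha> * (1 + \<theta>) * \<sigma>)"
    and M: "prob_space M"
    and seeds: "fresh_seeds M N m \<xi>"
    and init: "\<And>\<omega>. \<omega> \<in> space M \<Longrightarrow> x 0 \<omega> = x0"
    and step: "\<And>k \<omega>. \<omega> \<in> space M \<Longrightarrow>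
      x (Suc k) \<omega> = x k \<omega> - \<gamma> *\<^sub>R (\<Sum>i=1..m. Q (\<xi> k i \<omega>) (gradf i (x k \<omega>)))"
    and T: "1 \<le> T"
  shows "integrable M (\<lambda>\<omega>. F ((1 / real T) *\<^sub>R (\<Sum>k<T. x k \<omega>)) - F xstar) \<and>
    (\<integral>\<omega>. F ((1 / real T) *\<^sub>R (\<Sum>k<T. x k \<omega>)) - F xstar \<partial>M)
      \<le> 1 / \<gamma> * (1 / real T) * (norm (x0 - xstar))\<^sup>2
         + 1 / (\<theta> * L) * (\<Sum>i=1..m. (norm (gradf i xstar))\<^sup>2)"
proof -
  interpret prob_space M by (rule M)
  let ?I = "{1..m}"
  let ?S = "\<Sum>i\<in>?I. (norm (gradf i xstar))\<^sup>2"
  define \<kappa> where "\<kappa> = \<sigma> * \<alpha>"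
  have "1 \<le> \<sigma>"
    unfolding \<sigma> by (rule one_le_conflict_factor[OF m])
  moreover have "0 < \<alpha>"
    using quantizer by (simp add: unbiased_random_quantizer_def)
  ultimately have \<gamma>_pos: "0 < \<gamma>" and step_size: "\<gamma> * \<kappa> = 1 / (L * (1 + \<theta>))"
    using L \<theta> by (simp_all add: \<gamma> \<kappa>_def)
  have g_meas: "gradf i \<in> borel_measurable borel" if "i \<in> ?I" for i
    using smooth[OF that] by (intro borel_measurable_continuous_onI lipschitz_on_continuous_on)
  have F_meas [measurable]: "F \<in> borel_measurable borel"
  proof -
    have "continuous_on UNIV (f i)" if "i \<in> ?I" for i
      using gradient[OF that] unfolding gderiv_def
      by (intro continuous_at_imp_continuous_on ballI) (blast intro: has_derivative_continuous)
    then show ?thesis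
      unfolding F by (intro borel_measurable_continuous_onI continuous_on_sum) auto
  qed
  note fresh = iterate_independent_of_fresh_seed[where x = x, OF M quantizer g_meas seeds init step]
  have x_meas [measurable]: "x k \<in> borel_measurable M" for k
    using fresh(1)[of 1 k] m by simp
  have seed_meas: "\<xi> k i \<in> measurable M N"
    and seed_indep: "distr M (borel \<Otimes>\<^sub>M N) (\<lambda>\<omega>. (x k \<omega>, \<xi> k i \<omega>)) = distr M borel (x k) \<Otimes>\<^sub>M N"
    if "i \<in> ?I" for i k
    using fresh(2,3) that by simp_all

  (* The expectation of drift bounds the increment of E, the mean squared distance to xstar. *)
  define drift where "drift k \<omega> = \<gamma>\<^sup>2 * \<kappa> * (\<Sum>i\<in>?I. (norm (gradf i (x k \<omega>)))\<^sup>2)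
      - 2 * \<gamma> * (\<Sum>i\<in>?I. gradf i (x k \<omega>) \<bullet> (x k \<omega> - xstar))" for k \<omega>
  define gap where "gap k \<omega> = F (x k \<omega>) - F xstar" for k \<omega>
  define E where "E k = (\<integral>\<omega>. (norm (x k \<omega> - xstar))\<^sup>2 \<partial>M)" for k
  note one_step = expected_squared_distance_step[OF M quantizer x_meas seed_meas seed_indep smooth
      eq_refl[OF supp_gradient] m \<sigma>, where z = xstar and \<gamma> = \<gamma>, folded \<kappa>_def]
  have step': "(norm (x (Suc k) \<omega> - xstar))\<^sup>2
      = (norm (x k \<omega> - \<gamma> *\<^sub>R (\<Sum>i=1..m. Q (\<xi> k i \<omega>) (gradf i (x k \<omega>))) - xstar))\<^sup>2"
    if "\<omega> \<in> space M" for k \<omega>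
    using step[OF that] by simp
  have L2: "integrable M (\<lambda>\<omega>. (norm (x k \<omega> - xstar))\<^sup>2)" for k
  proof (induction k)
    case 0
    have "integrable M (\<lambda>\<omega>. (norm (x0 - xstar))\<^sup>2)" by simp
    then show ?case
      using init by (subst Bochner_Integration.integrable_cong[OF refl]) auto
  next
    case (Suc k)
    show ?case
      using one_step(1)[OF _ _ _ _ Suc] step'
      by (subst Bochner_Integration.integrable_cong[OF refl step']) auto
  qed
  have drift_int: "integrable M (drift k)" for k
    unfolding drift_def using one_step(2)[OF _ _ _ _ L2] by auto
  have E_Suc: "E (Suc k) \<le> E k + (\<integral>\<omega>. drift k \<omega> \<partial>M)" for k
    unfolding E_def drift_def
    by (subst Bochner_Integration.integral_cong[OF refl step'])
      (use one_step(3)[OF _ _ _ _ L2] in auto)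

  have gap_nonneg: "0 \<le> gap k \<omega>" for k \<omega>
    using minimizer by (simp add: gap_def)
  have gap_int: "integrable M (gap k)" for k
  proof (rule Bochner_Integration.integrable_bound)
    have "integrable M (\<lambda>\<omega>. gradf i (x k \<omega>) \<bullet> (x k \<omega> - xstar))" if "i \<in> ?I" for i
      using square_integrable_lipschitz[OF x_meas smooth[OF that] L2] L2 g_meas[OF that]
      by (intro integrable_inner_of_square_integrable) auto
    then show "integrable M (\<lambda>\<omega>. \<Sum>i\<in>?I. gradf i (x k \<omega>) \<bullet> (x k \<omega> - xstar))"
      by auto
    have "gap k \<omega> \<le> (\<Sum>i\<in>?I. gradf i (x k \<omega>) \<bullet> (x k \<omega> - xstar))" for \<omega>
    proof -
      have "f i (x k \<omega>) - f i xstar \<le> gradf i (x k \<omega>) \<bullet> (x k \<omega> - xstar)" if "i \<in> ?I" for i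
        using convex_gradient_lower_bound[OF convex[OF that] gradient[OF that], of "x k \<omega>" xstar]
        by (simp add: inner_diff_right)
      then show ?thesis
        unfolding gap_def F sum_subtractf[symmetric] by (rule sum_mono)
    qed
    then show "AE \<omega> in M. norm (gap k \<omega>)
        \<le> norm (\<Sum>i\<in>?I. gradf i (x k \<omega>) \<bullet> (x k \<omega> - xstar))"
      using gap_nonneg by (auto intro!: AE_I2 order_trans[OF _ abs_ge_self])
  qed (simp add: gap_def[abs_def])
  have gap_bound: "2 * \<gamma> * (\<integral>\<omega>. gap k \<omega> \<partial>M) \<le> E k - E (Suc k) + \<gamma> / (\<theta> * L) * ?S" for k
  proof -
    have "(\<integral>\<omega>. drift k \<omega> \<partial>M) \<le> (\<integral>\<omega>. \<gamma> / (\<theta> * L) * ?S - 2 * \<gamma> * gap k \<omega> \<partial>M)"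
    proof (rule integral_mono)
      show "drift k \<omega> \<le> \<gamma> / (\<theta> * L) * ?S - 2 * \<gamma> * gap k \<omega>" for \<omega>
        unfolding drift_def gap_def F
        using gradient convex smooth L \<theta> \<gamma>_pos step_size by (rule drift_le_noise_minus_gap)
    qed (use drift_int gap_int in auto)
    also have "\<dots> = \<gamma> / (\<theta> * L) * ?S - 2 * \<gamma> * (\<integral>\<omega>. gap k \<omega> \<partial>M)"
      using gap_int[of k] by (simp add: prob_space)
    finally show ?thesis
      using E_Suc[of k] by linarith
  qed
  have "2 * \<gamma> * (\<Sum>k<T. \<integral>\<omega>. gap k \<omega> \<partial>M) \<le> (\<Sum>k<T. E k - E (Suc k) + \<gamma> / (\<theta> * L) * ?S)"
    by (subst sum_distrib_left) (intro sum_mono gap_bound)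
  also have "\<dots> = E 0 - E T + real T * (\<gamma> / (\<theta> * L) * ?S)"
    by (simp add: sum.distrib sum_lessThan_telescope')
  also have "\<dots> \<le> (norm (x0 - xstar))\<^sup>2 + real T * (\<gamma> / (\<theta> * L) * ?S)"
  proof -
    have "E 0 = (\<integral>\<omega>. (norm (x0 - xstar))\<^sup>2 \<partial>M)"
      unfolding E_def by (rule Bochner_Integration.integral_cong) (auto simp: init)
    moreover have "0 \<le> E T"
      by (simp add: E_def)
    ultimately show ?thesis
      by (simp add: prob_space)
  qed
  finally have total_gap: "2 * \<gamma> * (\<Sum>k<T. \<integral>\<omega>. gap k \<omega> \<partial>M)
      \<le> (norm (x0 - xstar))\<^sup>2 + real T * (\<gamma> / (\<theta> * L) * ?S)" .

  let ?avg = "\<lambda>\<omega>. (1 / real T) *\<^sub>R (\<Sum>k<T. x k \<omega>)"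
  have jensen: "F (?avg \<omega>) - F xstar \<le> 1 / real T * (\<Sum>k<T. gap k \<omega>)" for \<omega>
  proof -
    have "f i (?avg \<omega>) \<le> 1 / real T * (\<Sum>k<T. f i (x k \<omega>))" if "i \<in> ?I" for i
      using convex_on_sum[of "{..<T}" UNIV "f i" "\<lambda>_. 1 / real T" "\<lambda>k. x k \<omega>"] convex[OF that] T
      by (simp add: scaleR_sum_right sum_distrib_left lessThan_empty_iff)
    then have "F (?avg \<omega>) \<le> (\<Sum>i\<in>?I. 1 / real T * (\<Sum>k<T. f i (x k \<omega>)))"
      unfolding F by (rule sum_mono)
    also have "\<dots> = 1 / real T * (\<Sum>k<T. F (x k \<omega>))"
      unfolding F sum_distrib_left[symmetric] by (subst sum.swap) (rule refl)
    finally show ?thesis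
      using T by (simp add: gap_def sum_subtractf diff_divide_distrib)
  qed
  have avg_int: "integrable M (\<lambda>\<omega>. F (?avg \<omega>) - F xstar)"
  proof (rule Bochner_Integration.integrable_bound)
    show "integrable M (\<lambda>\<omega>. 1 / real T * (\<Sum>k<T. gap k \<omega>))"
      using gap_int by auto
    show "AE \<omega> in M. norm (F (?avg \<omega>) - F xstar) \<le> norm (1 / real T * (\<Sum>k<T. gap k \<omega>))"
    proof (rule AE_I2)
      fix \<omega>
      show "norm (F (?avg \<omega>) - F xstar) \<le> norm (1 / real T * (\<Sum>k<T. gap k \<omega>))"
        using jensen[of \<omega>] minimizer[of "?avg \<omega>"] unfolding real_norm_def by linarith
    qed
  qed measurable
  have "(\<integral>\<omega>. F (?avg \<omega>) - F xstar \<partial>M) \<le> (\<integral>\<omega>. 1 / real T * (\<Sum>k<T. gap k \<omega>) \<partial>M)"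
    using avg_int gap_int jensen by (intro integral_mono) auto
  also have "\<dots> = 1 / (2 * \<gamma> * real T) * (2 * \<gamma> * (\<Sum>k<T. \<integral>\<omega>. gap k \<omega> \<partial>M))"
    using gap_int \<gamma>_pos by simp
  also have "\<dots> \<le> 1 / (2 * \<gamma> * real T) * ((norm (x0 - xstar))\<^sup>2 + real T * (\<gamma> / (\<theta> * L) * ?S))"
    using total_gap \<gamma>_pos by (intro mult_left_mono) auto
  also have "\<dots> = (1 / \<gamma> * (1 / real T) * (norm (x0 - xstar))\<^sup>2 + 1 / (\<theta> * L) * ?S) / 2"
    using \<gamma>_pos T L \<theta> by (simp add: field_simps)
  also have "\<dots> \<le> 1 / \<gamma> * (1 / real T) * (norm (x0 - xstar))\<^sup>2 + 1 / (\<theta> * L) * ?S"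
  proof -
    have half_le: "u / 2 \<le> u" if "0 \<le> u" for u :: real
      using that by simp
    show ?thesis
      using \<gamma>_pos L \<theta> by (intro half_le add_nonneg_nonneg) (simp_all add: sum_nonneg)
  qed
  finally show ?thesis
    using avg_int by blast
qed

end
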